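(* For $d\ge0$ let $$c(d)=\inf_{\gamma\in\Gamma}\ \max_{u\in\gamma([-1,1])}\mathcal{J}_d(u),\qquad \Gamma=\{\gamma\in C([-1,1],S):\gamma(-1)=-\phi_1,\ \gamma(1)=\phi_1\}.$$ The curve $d\mapsto(d+c(d),c(d))$, $d\in\mathbb{R}^+=[0,\infty)$, is nonincreasing (in the sense that $d_1<d_2$ implies $d_1+c(d_1)\le d_2+c(d_2)$ and $c(d_1)\ge c(d_2)$) and Lipschitz continuous.
   Context: Let $N$ be a positive integer, $0<s<1<p<N$, $\theta\in[s,1]$, and let $\Omega\subset\mathbb{R}^N$ be a bounded domain. $W_0^{1,p}(\Omega)$ is the closure of $C_c^\infty(\Omega)$ with respect to $\left(\int_\Omega|\nabla u|^p\right)^{1/p}$, and $X(\Omega)=\{u\in W^{1,p}(\mathbb{R}^N): u|_\Omega\in W_0^{1,p}(\Omega),\ u=0 \text{ a.e. in } \mathbb{R}^N\setminus\Omega\}$, with norm $\|u\|=\left(\int_\Omega|\nabla u|^p+[u]_{s,p}^p\right)^{1/p}$, $[u]_{s,p}^p=\int_{\mathbb{R}^N}\int_{\mathbb{R}^N}\frac{|u(x)-u(y)|^p}{|x-y|^{N+ps}}\,dx\,dy$. Constants: $C_H=\left(\frac{N-p}{p}\right)^p$; $C_{N,p,s}=2\int_0^1 r^{ps-1}|1-r^{(N-ps)/p}|^p\Psi_{N,s,p}(r)\,dr$ with $\Psi_{N,s,p}(r)=|\mathbb{S}^{N-2}|\int_{-1}^1\frac{(1-t^2)^{(N-3)/2}}{(1-2rt+r^2)^{(N+ps)/2}}\,dt$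 ($N\ge2$). Set $\mu_0(\theta)=C_{N,p,s}$ if $\theta=s$; $\mu_0(\theta)=\min\left\{\frac{C_H(1-s)}{\theta-s},\frac{C_{N,p,s}(1-s)}{1-\theta}\right\}$ if $\theta\in(s,1)$; $\mu_0(\theta)=C_H$ if $\theta=1$. Fix $\mu\in(0,\mu_0(\theta))$. For $d\ge0$, $\mathcal{J}_d(u)=\int_\Omega|\nabla u|^p+[u]_{s,p}^p-\mu\int_\Omega\frac{|u|^p}{|x|^{p\theta}}-d\int_\Omega(u^+)^p$ on $X(\Omega)$, where $u^+=\max\{u,0\}$; $S=\{u\in X(\Omega):\int_\Omega|u|^p=1\}$ with the topology of $X(\Omega)$; $\lambda_1(\Omega)=\inf_{S}\mathcal{J}_0$; and $\phi_1\in S$ is the (unique) positive function with $\mathcal{J}_0(\phi_1)=\lambda_1(\Omega)$. *)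

theory Defs
  imports "HOL-Analysis.Analysis"
begin

text \<open>
  Elements of Sobolev spaces are represented by Borel functions on the whole of \<open>\<real>\<^sup>N\<close>
  (every almost-everywhere class has such a representative), where \<open>\<real>\<^sup>N\<close> is a type
  \<open>'a :: euclidean_space\<close> with \<open>N = DIM('a)\<close>. Equality of elements is equality almost everywhere.
\<close>

primrec Ck :: "nat \<Rightarrow> ('a::euclidean_space \<Rightarrow> real) \<Rightarrow> bool" where
  "Ck 0 f \<longleftrightarrow> continuous_on UNIV f"
| "Ck (Suc k) f \<longleftrightarrow> (\<forall>x. f differentiable (at x)) \<and>
     (\<forall>i\<in>Basis. Ck k (\<lambda>x. frechet_derivative f (at x) i))"

definition test_functions :: "'a::euclidean_space set \<Rightarrow> ('a \<Rightarrow> real) set" where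
  "test_functions \<Omega> = {\<phi>. (\<forall>k. Ck k \<phi>) \<and>
     compact (closure {x. \<phi> x \<noteq> 0}) \<and> closure {x. \<phi> x \<noteq> 0} \<subseteq> \<Omega>}"

definition has_weak_gradient ::
  "'a::euclidean_space set \<Rightarrow> ('a \<Rightarrow> real) \<Rightarrow> ('a \<Rightarrow> 'a) \<Rightarrow> bool" where
  "has_weak_gradient \<Omega> u g \<longleftrightarrow>
     (\<forall>K. compact K \<and> K \<subseteq> \<Omega> \<longrightarrow> set_integrable lborel K u \<and> set_integrable lborel K g) \<and>
     (\<forall>\<phi>\<in>test_functions \<Omega>. \<forall>i\<in>Basis.
        (LINT x:\<Omega>|lborel. u x * frechet_derivative \<phi> (at x) i) =
        - (LINT x:\<Omega>|lborel. (g x \<bullet> i) * \<phi> x))"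

text \<open>The weak gradient is unique up to a null set of \<open>\<Omega>\<close>, so integrals of it do not depend on
  the choice.\<close>

definition weak_gradient :: "'a::euclidean_space set \<Rightarrow> ('a \<Rightarrow> real) \<Rightarrow> 'a \<Rightarrow> 'a" where
  "weak_gradient \<Omega> u = (SOME g. has_weak_gradient \<Omega> u g)"

definition sobolev :: "real \<Rightarrow> 'a::euclidean_space set \<Rightarrow> ('a \<Rightarrow> real) set" where
  "sobolev p \<Omega> = {u \<in> borel_measurable borel.
     set_integrable lborel \<Omega> (\<lambda>x. \<bar>u x\<bar> powr p) \<and>
     (\<exists>g. has_weak_gradient \<Omega> u g \<and> set_integrable lborel \<Omega> (\<lambda>x. norm (g x) powr p))}"

definition dirichlet_energy :: "real \<Rightarrow> 'a::euclidean_space set \<Rightarrow> ('a \<Rightarrow> real) \<Rightarrow> real" where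
  "dirichlet_energy p \<Omega> u = (LINT x:\<Omega>|lborel. norm (weak_gradient \<Omega> u x) powr p)"

text \<open>
  The gradient seminorm is a norm on test functions, but not on all of \<open>W\<^sup>1\<^sup>,\<^sup>p(\<Omega>)\<close> (it vanishes
  on constants). The closure is therefore the completion realised as a space of functions:
  the element represented by a sequence of test functions is its \<open>L\<^sup>p(\<Omega>)\<close>-limit, which exists
  on bounded \<open>\<Omega>\<close> by Poincare's inequality.
\<close>

definition sobolev0 :: "real \<Rightarrow> 'a::euclidean_space set \<Rightarrow> ('a \<Rightarrow> real) set" where
  "sobolev0 p \<Omega> = {u \<in> sobolev p \<Omega>. \<exists>\<phi>. (\<forall>n::nat. \<phi> n \<in> test_functions \<Omega>) \<and>
     (\<lambda>n. dirichlet_energy p \<Omega> (\<lambda>x. \<phi> n x - u x)) \<longlonglongrightarrow> 0 \<and>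
     (\<lambda>n. LINT x:\<Omega>|lborel. \<bar>\<phi> n x - u x\<bar> powr p) \<longlonglongrightarrow> 0}"

text \<open>\<open>[u]\<^sub>s\<^sub>,\<^sub>p\<^sup>p\<close>; on the diagonal the integrand is \<open>0 / 0 = 0\<close>.\<close>

definition gagliardo :: "real \<Rightarrow> real \<Rightarrow> ('a::euclidean_space \<Rightarrow> real) \<Rightarrow> real" where
  "gagliardo s p u = (LINT x|lborel. LINT y|lborel.
     \<bar>u x - u y\<bar> powr p / norm (x - y) powr (real DIM('a) + p * s))"

definition X_space :: "real \<Rightarrow> 'a::euclidean_space set \<Rightarrow> ('a \<Rightarrow> real) set" where
  "X_space p \<Omega> = {u \<in> sobolev p UNIV. u \<in> sobolev0 p \<Omega> \<and> (AE x in lborel. x \<notin> \<Omega> \<longrightarrow> u x = 0)}"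

definition X_norm :: "real \<Rightarrow> real \<Rightarrow> 'a::euclidean_space set \<Rightarrow> ('a \<Rightarrow> real) \<Rightarrow> real" where
  "X_norm s p \<Omega> u = (dirichlet_energy p \<Omega> u + gagliardo s p u) powr (1 / p)"

definition C_H :: "nat \<Rightarrow> real \<Rightarrow> real" where
  "C_H N p = ((real N - p) / p) powr p"

text \<open>\<open>|\<S>\<^sup>k\<^sup>-\<^sup>1| = 2 \<pi>\<^sup>k\<^sup>/\<^sup>2 / \<Gamma>(k/2)\<close>, the surface measure of the unit sphere of \<open>\<real>\<^sup>k\<close>, \<open>k \<ge> 1\<close>
  (so \<open>|\<S>\<^sup>0| = 2\<close>).\<close>

definition sphere_area :: "nat \<Rightarrow> real" where
  "sphere_area k = 2 * pi powr (real k / 2) / Gamma (real k / 2)"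

definition Psi :: "nat \<Rightarrow> real \<Rightarrow> real \<Rightarrow> real \<Rightarrow> real" where
  "Psi N s p r = sphere_area (N - 1) *
     (LINT t:{-1..1}|lborel. (1 - t\<^sup>2) powr ((real N - 3) / 2) /
        (1 - 2 * r * t + r\<^sup>2) powr ((real N + p * s) / 2))"

definition C_frac :: "nat \<Rightarrow> real \<Rightarrow> real \<Rightarrow> real" where
  "C_frac N p s = 2 * (LINT r:{0..1}|lborel. r powr (p * s - 1) *
     \<bar>1 - r powr ((real N - p * s) / p)\<bar> powr p * Psi N s p r)"

definition mu0 :: "nat \<Rightarrow> real \<Rightarrow> real \<Rightarrow> real \<Rightarrow> real" where
  "mu0 N p s \<theta> =
     (if \<theta> = s then C_frac N p s
      else if \<theta> = 1 then C_H N p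
      else min (C_H N p * (1 - s) / (\<theta> - s)) (C_frac N p s * (1 - s) / (1 - \<theta>)))"

definition J :: "real \<Rightarrow> real \<Rightarrow> real \<Rightarrow> real \<Rightarrow> 'a::euclidean_space set \<Rightarrow> real \<Rightarrow>
    ('a \<Rightarrow> real) \<Rightarrow> real" where
  "J s p \<theta> \<mu> \<Omega> d u = dirichlet_energy p \<Omega> u + gagliardo s p u
     - \<mu> * (LINT x:\<Omega>|lborel. \<bar>u x\<bar> powr p / norm x powr (p * \<theta>))
     - d * (LINT x:\<Omega>|lborel. (max (u x) 0) powr p)"

definition unit_sphere :: "real \<Rightarrow> 'a::euclidean_space set \<Rightarrow> ('a \<Rightarrow> real) set" where
  "unit_sphere p \<Omega> = {u \<in> X_space p \<Omega>. (LINT x:\<Omega>|lborel. \<bar>u x\<bar> powr p) = 1}"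

definition lambda1 :: "real \<Rightarrow> real \<Rightarrow> real \<Rightarrow> real \<Rightarrow> 'a::euclidean_space set \<Rightarrow> real" where
  "lambda1 s p \<theta> \<mu> \<Omega> = (INF u\<in>unit_sphere p \<Omega>. J s p \<theta> \<mu> \<Omega> 0 u)"

definition is_first_eigenfunction :: "real \<Rightarrow> real \<Rightarrow> real \<Rightarrow> real \<Rightarrow> 'a::euclidean_space set \<Rightarrow>
    ('a \<Rightarrow> real) \<Rightarrow> bool" where
  "is_first_eigenfunction s p \<theta> \<mu> \<Omega> \<phi> \<longleftrightarrow>
     \<phi> \<in> unit_sphere p \<Omega> \<and> (AE x in lborel. x \<in> \<Omega> \<longrightarrow> 0 < \<phi> x) \<and>
     J s p \<theta> \<mu> \<Omega> 0 \<phi> = lambda1 s p \<theta> \<mu> \<Omega>"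

definition paths :: "real \<Rightarrow> real \<Rightarrow> 'a::euclidean_space set \<Rightarrow> ('a \<Rightarrow> real) \<Rightarrow>
    (real \<Rightarrow> 'a \<Rightarrow> real) set" where
  "paths s p \<Omega> \<phi> = {\<gamma>.
     (\<forall>t\<in>{-1..1}. \<gamma> t \<in> unit_sphere p \<Omega>) \<and>
     (\<forall>t\<in>{-1..1}. ((\<lambda>\<tau>. X_norm s p \<Omega> (\<lambda>x. \<gamma> \<tau> x - \<gamma> t x)) \<longlongrightarrow> 0) (at t within {-1..1})) \<and>
     (AE x in lborel. \<gamma> (-1) x = - \<phi> x) \<and> (AE x in lborel. \<gamma> 1 x = \<phi> x)}"

text \<open>The supremum along a path is a maximum: by Hardy's inequality the functional is continuous
  on \<open>X(\<Omega>)\<close>, and the path is compact.\<close>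

definition minimax :: "real \<Rightarrow> real \<Rightarrow> real \<Rightarrow> real \<Rightarrow> 'a::euclidean_space set \<Rightarrow>
    ('a \<Rightarrow> real) \<Rightarrow> real \<Rightarrow> real" where
  "minimax s p \<theta> \<mu> \<Omega> \<phi> d =
     (INF \<gamma>\<in>paths s p \<Omega> \<phi>. SUP u\<in>\<gamma> ` {-1..1}. J s p \<theta> \<mu> \<Omega> d u)"

end

theory Submission
  imports Defs
begin

text \<open>
  On the unit sphere the coefficient of \<open>-d\<close> in \<open>J\<^sub>d(u)\<close>, the integral of \<open>(u\<^sup>+)\<^sup>p\<close>, lies between
  \<open>0\<close> and the integral of \<open>\<bar>u\<bar>\<^sup>p\<close>, which is \<open>1\<close>. So for \<open>d \<le> e\<close> the functionals are ordered and close,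
  \<open>J\<^sub>e \<le> J\<^sub>d \<le> J\<^sub>e + (e - d)\<close>, at every point of every admissible path. Taking suprema along a path
  and then the infimum over all paths preserves both inequalities, which yields
  \<open>c(e) \<le> c(d) \<le> c(e) + (e - d)\<close>. The left half says that \<open>c\<close> is nonincreasing, the right half that
  \<open>d + c(d)\<close> is nondecreasing, and together they make both coordinates of the curve Lipschitz with
  constant \<open>1\<close>.

  The transfer of the inequalities is proved for the total operators \<open>Sup\<close> and \<open>Inf\<close> on the reals,
  which give one fixed default value to all sets without the relevant bound. Two functions at bounded
  distance from each other have bounds simultaneously, so both sides then take the same default
  value and the inequalities persist.
\<close>

text \<open>
  The supremum of a set of reals is the least element of its set of upper bounds, and for both sets
  this is the least element of the same, empty, set.
\<close>

lemma real_Sup_unbounded: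
  fixes X Y :: "real set"
  assumes "\<not> bdd_above X" "\<not> bdd_above Y"
  shows "Sup X = Sup Y"
proof -
  have "(\<lambda>z. \<forall>x\<in>X. x \<le> z) = (\<lambda>z. \<forall>x\<in>Y. x \<le> z)"
    using assms unfolding bdd_above_def by (intro ext) blast
  then show ?thesis
    unfolding Sup_real_def by simp
qed

text \<open>
  For an empty index set, or when neither image has an upper bound, the two suprema coincide, and the
  claim reduces to \<open>0 \<le> k\<close>.
\<close>

lemma real_SUP_between:
  fixes f g :: "'b \<Rightarrow> real"
  assumes "0 \<le> k"
    and le: "\<And>x. x \<in> A \<Longrightarrow> f x \<le> g x"
    and ge: "\<And>x. x \<in> A \<Longrightarrow> g x \<le> f x + k"
  shows "(SUP x\<in>A. f x) \<le> (SUP x\<in>A. g x)" and "(SUP x\<in>A. g x) \<le> (SUP x\<in>A. f x) + k"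
proof -
  have bdd_iff: "bdd_above (f ` A) \<longleftrightarrow> bdd_above (g ` A)"
  proof
    assume "bdd_above (f ` A)"
    then obtain M where "\<And>x. x \<in> A \<Longrightarrow> f x \<le> M"
      by (auto simp: bdd_above_def)
    with ge show "bdd_above (g ` A)"
      by (intro bdd_aboveI2[where M = "M + k"]) (smt (verit))
  next
    assume "bdd_above (g ` A)"
    then obtain M where "\<And>x. x \<in> A \<Longrightarrow> g x \<le> M"
      by (auto simp: bdd_above_def)
    with le show "bdd_above (f ` A)"
      by (intro bdd_aboveI2[where M = M]) (smt (verit))
  qed
  have "(SUP x\<in>A. f x) \<le> (SUP x\<in>A. g x) \<and> (SUP x\<in>A. g x) \<le> (SUP x\<in>A. f x) + k"
  proof (cases "A \<noteq> {} \<and> bdd_above (g ` A)")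
    case True
    have "(SUP x\<in>A. f x) \<le> (SUP x\<in>A. g x)"
      using True le by (intro cSUP_mono) auto
    moreover have "(SUP x\<in>A. g x) \<le> (SUP x\<in>A. f x) + k"
    proof (rule cSUP_least)
      fix x assume x: "x \<in> A"
      then have "f x \<le> (SUP x\<in>A. f x)"
        using True bdd_iff by (intro cSUP_upper) auto
      with ge[OF x] show "g x \<le> (SUP x\<in>A. f x) + k"
        by simp
    qed (use True in simp)
    ultimately show ?thesis ..
  next
    case False
    then have "(SUP x\<in>A. f x) = (SUP x\<in>A. g x)"
      using real_Sup_unbounded[of "f ` A" "g ` A"] bdd_iff by (cases "A = {}") simp_all
    with \<open>0 \<le> k\<close> show ?thesis
      by simp
  qed
  then show "(SUP x\<in>A. f x) \<le> (SUP x\<in>A. g x)" "(SUP x\<in>A. g x) \<le> (SUP x\<in>A. f x) + k"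
    by auto
qed

lemma real_INF_between:
  fixes f g :: "'b \<Rightarrow> real"
  assumes "0 \<le> k"
    and "\<And>x. x \<in> A \<Longrightarrow> f x \<le> g x"
    and "\<And>x. x \<in> A \<Longrightarrow> g x \<le> f x + k"
  shows "(INF x\<in>A. f x) \<le> (INF x\<in>A. g x)" and "(INF x\<in>A. g x) \<le> (INF x\<in>A. f x) + k"
proof -
  have INF_eq: "(INF x\<in>A. h x) = - (SUP x\<in>A. - h x)" for h :: "'b \<Rightarrow> real"
    by (simp add: Inf_real_def image_image)
  have "(SUP x\<in>A. - g x) \<le> (SUP x\<in>A. - f x)" "(SUP x\<in>A. - f x) \<le> (SUP x\<in>A. - g x) + k"
    using real_SUP_between[of k A "\<lambda>x. - g x" "\<lambda>x. - f x"] assms by force+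
  then show "(INF x\<in>A. f x) \<le> (INF x\<in>A. g x)" "(INF x\<in>A. g x) \<le> (INF x\<in>A. f x) + k"
    unfolding INF_eq by simp_all
qed

lemma unit_sphere_positive_part:
  fixes u :: "'a::euclidean_space \<Rightarrow> real"
  assumes "0 \<le> p" "\<Omega> \<in> sets borel" "u \<in> unit_sphere p \<Omega>"
  shows "0 \<le> (LINT x:\<Omega>|lborel. (max (u x) 0) powr p)"
    and "(LINT x:\<Omega>|lborel. (max (u x) 0) powr p) \<le> 1"
proof -
  have u: "u \<in> borel_measurable borel" "set_integrable lborel \<Omega> (\<lambda>x. \<bar>u x\<bar> powr p)"
    and unit: "(LINT x:\<Omega>|lborel. \<bar>u x\<bar> powr p) = 1"
    using assms(3) by (auto simp: unit_sphere_def X_space_def sobolev0_def sobolev_def)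
  have le: "(max (u x) 0) powr p \<le> \<bar>u x\<bar> powr p" for x
    using \<open>0 \<le> p\<close> by (intro powr_mono2) auto
  have "set_integrable lborel \<Omega> (\<lambda>x. (max (u x) 0) powr p)"
    using u(2) unfolding set_integrable_def
  proof (rule Bochner_Integration.integrable_bound)
    show "(\<lambda>x. indicator \<Omega> x *\<^sub>R (max (u x) 0) powr p) \<in> borel_measurable lborel"
      using u(1) assms(2) by measurable
    show "AE x in lborel. norm (indicator \<Omega> x *\<^sub>R (max (u x) 0) powr p)
        \<le> norm (indicator \<Omega> x *\<^sub>R \<bar>u x\<bar> powr p)"
      using le by (auto simp: indicator_def)
  qed
  then have "(LINT x:\<Omega>|lborel. (max (u x) 0) powr p) \<le> (LINT x:\<Omega>|lborel. \<bar>u x\<bar> powr p)"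
    using u(2) le by (intro set_integral_mono)
  with unit show "(LINT x:\<Omega>|lborel. (max (u x) 0) powr p) \<le> 1"
    by simp
  show "0 \<le> (LINT x:\<Omega>|lborel. (max (u x) 0) powr p)"
    unfolding set_lebesgue_integral_def by (intro Bochner_Integration.integral_nonneg) auto
qed

lemma J_between:
  assumes "0 \<le> p" "\<Omega> \<in> sets borel" "u \<in> unit_sphere p \<Omega>" "d \<le> e"
  shows "J s p \<theta> \<mu> \<Omega> e u \<le> J s p \<theta> \<mu> \<Omega> d u"
    and "J s p \<theta> \<mu> \<Omega> d u \<le> J s p \<theta> \<mu> \<Omega> e u + (e - d)"
proof -
  define P where "P = (LINT x:\<Omega>|lborel. (max (u x) 0) powr p)"
  have "0 \<le> P" "P \<le> 1"
    using unit_sphere_positive_part[OF assms(1-3)] by (auto simp: P_def)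
  then have "0 \<le> (e - d) * P" "(e - d) * P \<le> e - d"
    using \<open>d \<le> e\<close> by (auto simp: mult_left_le)
  moreover have "J s p \<theta> \<mu> \<Omega> d u = J s p \<theta> \<mu> \<Omega> e u + (e - d) * P"
    by (simp add: J_def P_def algebra_simps)
  ultimately show "J s p \<theta> \<mu> \<Omega> e u \<le> J s p \<theta> \<mu> \<Omega> d u"
    "J s p \<theta> \<mu> \<Omega> d u \<le> J s p \<theta> \<mu> \<Omega> e u + (e - d)"
    by auto
qed

lemma minimax_between:
  assumes "0 \<le> p" "\<Omega> \<in> sets borel" "d \<le> e"
  shows "minimax s p \<theta> \<mu> \<Omega> \<phi> e \<le> minimax s p \<theta> \<mu> \<Omega> \<phi> d"
    and "minimax s p \<theta> \<mu> \<Omega> \<phi> d \<le> minimax s p \<theta> \<mu> \<Omega> \<phi> e + (e - d)"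
proof -
  have on_path:
    "(SUP u\<in>\<gamma> ` {-1..1}. J s p \<theta> \<mu> \<Omega> e u) \<le> (SUP u\<in>\<gamma> ` {-1..1}. J s p \<theta> \<mu> \<Omega> d u)"
    "(SUP u\<in>\<gamma> ` {-1..1}. J s p \<theta> \<mu> \<Omega> d u) \<le> (SUP u\<in>\<gamma> ` {-1..1}. J s p \<theta> \<mu> \<Omega> e u) + (e - d)"
    if "\<gamma> \<in> paths s p \<Omega> \<phi>" for \<gamma>
  proof -
    have sphere: "u \<in> unit_sphere p \<Omega>" if "u \<in> \<gamma> ` {-1..1}" for u
      using that \<open>\<gamma> \<in> paths s p \<Omega> \<phi>\<close> by (auto simp: paths_def)
    show "(SUP u\<in>\<gamma> ` {-1..1}. J s p \<theta> \<mu> \<Omega> e u) \<le> (SUP u\<in>\<gamma> ` {-1..1}. J s p \<theta> \<mu> \<Omega> d u)"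
      "(SUP u\<in>\<gamma> ` {-1..1}. J s p \<theta> \<mu> \<Omega> d u) \<le> (SUP u\<in>\<gamma> ` {-1..1}. J s p \<theta> \<mu> \<Omega> e u) + (e - d)"
      using J_between[OF assms(1,2) sphere assms(3)] assms(3)
      by (intro real_SUP_between[where k = "e - d" and A = "\<gamma> ` {-1..1}"]; simp)+
  qed
  show "minimax s p \<theta> \<mu> \<Omega> \<phi> e \<le> minimax s p \<theta> \<mu> \<Omega> \<phi> d"
    "minimax s p \<theta> \<mu> \<Omega> \<phi> d \<le> minimax s p \<theta> \<mu> \<Omega> \<phi> e + (e - d)"
    using on_path assms(3) unfolding minimax_def
    by (intro real_INF_between[where k = "e - d" and A = "paths s p \<Omega> \<phi>"]; simp)+
qed

theorem proposition5p4:
  fixes \<Omega> :: "'a::euclidean_space set"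
    and s p \<theta> \<mu> :: real
    and \<phi>1 :: "'a \<Rightarrow> real"
    and c :: "real \<Rightarrow> real"
  assumes "0 < s" "s < 1" "1 < p" "p < real DIM('a)"
    and "s \<le> \<theta>" "\<theta> \<le> 1"
    and "open \<Omega>" "connected \<Omega>" "\<Omega> \<noteq> {}" "bounded \<Omega>"
    and "0 < \<mu>" "\<mu> < mu0 DIM('a) p s \<theta>"
    and "is_first_eigenfunction s p \<theta> \<mu> \<Omega> \<phi>1"
    and "\<And>d. 0 \<le> d \<Longrightarrow> c d = minimax s p \<theta> \<mu> \<Omega> \<phi>1 d"
  shows "(\<forall>d1 d2. 0 \<le> d1 \<and> d1 < d2 \<longrightarrow> d1 + c d1 \<le> d2 + c d2 \<and> c d2 \<le> c d1) \<and>
         (\<exists>L. L-lipschitz_on {0..} (\<lambda>d. (d + c d, c d)))"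
proof
  have c: "c e \<le> c d" "c d \<le> c e + (e - d)" if "0 \<le> d" "d \<le> e" for d e
    using minimax_between[of p \<Omega> d e s \<theta> \<mu> \<phi>1] that assms(3,7,14) by auto
  then show "\<forall>d1 d2. 0 \<le> d1 \<and> d1 < d2 \<longrightarrow> d1 + c d1 \<le> d2 + c d2 \<and> c d2 \<le> c d1"
    by (smt (verit))
  have "2-lipschitz_on {0..} (\<lambda>d. (d + c d, c d))"
  proof (rule lipschitz_onI)
    fix d e :: real
    assume "d \<in> {0..}" "e \<in> {0..}"
    then have "\<bar>(d + c d) - (e + c e)\<bar> \<le> \<bar>d - e\<bar>" "\<bar>c d - c e\<bar> \<le> \<bar>d - e\<bar>"
      using c[of d e] c[of e d] by (cases "d \<le> e"; simp)+
    moreover have "dist (d + c d, c d) (e + c e, c e) \<le> \<bar>(d + c d) - (e + c e)\<bar> + \<bar>c d - c e\<bar>"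
      unfolding dist_Pair_Pair dist_real_def by (rule sqrt_sum_squares_le_sum) auto
    ultimately show "dist (d + c d, c d) (e + c e, c e) \<le> 2 * dist d e"
      by (simp add: dist_real_def)
  qed simp
  then show "\<exists>L. L-lipschitz_on {0..} (\<lambda>d. (d + c d, c d))" ..
qed

end
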